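(* Let $n\ge2$ and let $V^1,V^2\in C([0,\infty);\mathbb{R}^{n-1})$. For $i=1,2$ let $(Z^i,\eta^i)$ be a solution of the Skorohod-type problem $$dZ(t)=n^2A^nZ(t)\,dt+d\eta(t),\qquad Z(t)\ge -V(t),\qquad \int_0^T\langle Z(t)+V(t),d\eta(t)\rangle=0\ \text{ for all }T>0,$$ with $V$ replaced by $V^i$. Then for every $k\in\{1,\dots,n-1\}$ and every $T>0$, $$\sup_{0\le t\le T}|Z^1_k(t)-Z^2_k(t)|\le\sup_{0\le t\le T,\,1\le j\le n-1}|V^1_j(t)-V^2_j(t)|.$$
   Context: $A^n=(A^n_{ki})$ is the $(n-1)\times(n-1)$ matrix with $A^n_{kk}=-2$, $A^n_{ki}=1$ if $|k-i|=1$, and $A^n_{ki}=0$ if $|k-i|>1$. For $a,b\in\mathbb{R}^{n-1}$, $a\ge b$ means $a_i\ge b_i$ for all $i$; $\langle\cdot,\cdot\rangle$ is the Euclidean inner product. A pair $(Z,\eta)$ is a solution of the problem with data $V=(V_1,\dots,V_{n-1})$ if: (1) $Z=(Z_1,\dots,Z_{n-1})\in C([0,\infty);\mathbb{R}^{n-1})$ and $Z(t)\ge -V(t)$ for all $t\ge 0$; (2) $\eta=(\eta_1,\dots,\eta_{n-1})\in C([0,\infty);\mathbb{R}^{n-1})$ and each $\eta_i$ is an increasing (non-decreasing) continuous function with $\eta_i(0)=0$; (3) for all $t\ge0$, $Z(t)=\int_0^tn^2A^nZ(s)\,ds+\eta(t)$; (4) for all $t\ge0$, $\sum_{i=1}^{n-1}\int_0^t(Z_i(s)+V_i(s))\,\eta_i(ds)=0$.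 *)

theory Defs
  imports "HOL-Analysis.Analysis"
begin

text \<open>
  Vectors in R^(n-1) are functions \<open>nat \<Rightarrow> real\<close> of which only the components with index in
  \<open>{1..n-1}\<close> matter, and paths are functions \<open>real \<Rightarrow> nat \<Rightarrow> real\<close> (time first) of which only
  the values at times \<open>t \<ge> 0\<close> matter.
\<close>

text \<open>The entries do not depend on \<open>n\<close>; the size \<open>n - 1\<close> enters through the range of the indices.\<close>

definition lap_entry :: "nat \<Rightarrow> nat \<Rightarrow> real" where
  "lap_entry k i =
     (if k = i then -2 else if \<bar>int k - int i\<bar> = 1 then 1 else 0)"

definition lap_mult :: "nat \<Rightarrow> (nat \<Rightarrow> real) \<Rightarrow> nat \<Rightarrow> real" where
  "lap_mult n z k = (\<Sum>i = 1..n - 1. lap_entry k i * z i)"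

text \<open>Continuity into the finite-dimensional space R^(n-1) is continuity of each component.\<close>

definition cont_path :: "nat \<Rightarrow> (real \<Rightarrow> nat \<Rightarrow> real) \<Rightarrow> bool" where
  "cont_path n f \<longleftrightarrow> (\<forall>k\<in>{1..n - 1}. continuous_on {0..} (\<lambda>t. f t k))"

text \<open>
  The Lebesgue--Stieltjes measure \<open>g(ds)\<close> of a function \<open>g\<close> that is continuous and nondecreasing
  on \<open>[0,\<infinity>)\<close>. Since \<open>interval_measure\<close> expects a function on the whole line, \<open>g\<close> is extended
  by the constant \<open>g 0\<close> to the left, so that \<open>(-\<infinity>,0]\<close> gets measure zero.
\<close>

definition stieltjes_measure :: "(real \<Rightarrow> real) \<Rightarrow> real measure" where
  "stieltjes_measure g = interval_measure (\<lambda>s. g (max 0 s))"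

definition skorohod_solution ::
  "nat \<Rightarrow> (real \<Rightarrow> nat \<Rightarrow> real) \<Rightarrow> (real \<Rightarrow> nat \<Rightarrow> real) \<Rightarrow> (real \<Rightarrow> nat \<Rightarrow> real) \<Rightarrow> bool" where
  "skorohod_solution n V Z \<eta> \<longleftrightarrow>
     cont_path n Z \<and>
     (\<forall>t\<ge>0. \<forall>k\<in>{1..n - 1}. Z t k \<ge> - V t k) \<and>
     cont_path n \<eta> \<and>
     (\<forall>k\<in>{1..n - 1}. mono_on {0..} (\<lambda>t. \<eta> t k) \<and> \<eta> 0 k = 0) \<and>
     (\<forall>t\<ge>0. \<forall>k\<in>{1..n - 1}.
        Z t k = integral {0..t} (\<lambda>s. (real n)\<^sup>2 * lap_mult n (Z s) k) + \<eta> t k) \<and>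
     (\<forall>t\<ge>0.
        (\<Sum>i = 1..n - 1.
           (LINT s:{0..t}|stieltjes_measure (\<lambda>r. \<eta> r i). Z s i + V s i)) = 0)"

end

theory Submission
  imports Defs
begin

text \<open>
  Let \<open>K\<close> bound \<open>\<bar>V1 - V2\<bar>\<close>. Whenever \<open>Z1 t k - Z2 t k > K\<close>, the first solution lies strictly above
  its obstacle, so \<open>\<eta>1\<close> does not charge a neighbourhood of \<open>t\<close> in the \<open>k\<close>-th coordinate. The
  difference is then a subsolution of the discrete heat equation with zero boundary values, and it
  cannot cross the barrier \<open>K + e * (1 + t)\<close> at a first time, by the maximum principle; let
  \<open>e\<close> tend to \<open>0\<close>.
\<close>

section \<open>Maximum principle for the discrete Laplacian\<close>

text \<open>The diagonal -2 outweighs at most two neighbours with entry 1. Neighbours at 0 and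
  \<open>n\<close> fall outside the index range, which encodes zero boundary values, so a row next
  to the boundary has negative sum.\<close>

lemma lap_entry_row_sum_nonpos:
  assumes "k \<in> {1..n - 1}"
  shows "(\<Sum>i = 1..n - 1. lap_entry k i) \<le> 0"
proof -
  \<comment> \<open>Since \<open>k\<close> is at least 1, the subtraction \<open>k - 1\<close> does
    not truncate.\<close>
  have "lap_entry k i = (if i = Suc k then 1 else 0) + (if i = k - 1 then 1 else 0)
          + (if i = k then -2 else 0)" for i
    using assms by (auto simp: lap_entry_def)
  then have "(\<Sum>i = 1..n - 1. lap_entry k i) =
      (\<Sum>i = 1..n - 1. if i = Suc k then 1 else 0) + (\<Sum>i = 1..n - 1. if i = k - 1 then 1 else 0)
      + (\<Sum>i = 1..n - 1. if i = k then -2 else 0)"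
    by (simp only: sum.distrib)
  also have "\<dots> \<le> 0"
    using assms by (subst (1 2 3) sum.delta) auto
  finally show ?thesis .
qed

text \<open>Off-diagonal entries are nonnegative, so replacing every \<open>z i\<close> by the
  maximum \<open>z k\<close> can only increase the sum. What remains is the row sum times
  \<open>z k\<close>, and the sign of \<open>z k\<close> matters because the row sum may be
  negative.\<close>

lemma lap_mult_nonpos_at_max:
  assumes k: "k \<in> {1..n - 1}" and max: "\<And>i. i \<in> {1..n - 1} \<Longrightarrow> z i \<le> z k" and "0 \<le> z k"
  shows "lap_mult n z k \<le> 0"
proof -
  have "lap_mult n z k \<le> (\<Sum>i = 1..n - 1. lap_entry k i * z k)"
    unfolding lap_mult_def
  proof (rule sum_mono)
    fix i assume "i \<in> {1..n - 1}"
    with max[of i] show "lap_entry k i * z i \<le> lap_entry k i * z k"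
      by (auto simp: lap_entry_def)
  qed
  also have "\<dots> = (\<Sum>i = 1..n - 1. lap_entry k i) * z k"
    by (simp add: sum_distrib_right)
  also have "\<dots> \<le> 0"
    using lap_entry_row_sum_nonpos[OF k] \<open>0 \<le> z k\<close> by (simp add: mult_nonpos_nonneg)
  finally show ?thesis .
qed

lemma lap_mult_diff: "lap_mult n (\<lambda>i. x i - y i) k = lap_mult n x k - lap_mult n y k"
  by (simp add: lap_mult_def algebra_simps sum_subtractf)

lemma continuous_on_lap_mult:
  assumes "cont_path n Z"
  shows "continuous_on {0..} (\<lambda>s. lap_mult n (Z s) k)"
  unfolding lap_mult_def using assms by (auto simp: cont_path_def intro!: continuous_intros)

section \<open>Stieltjes measures of continuous nondecreasing functions\<close>

context
  fixes g :: "real \<Rightarrow> real"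
  assumes mono: "mono_on {0..} g" and cont: "continuous_on {0..} g"
begin

lemma emeasure_stieltjes_Ioc:
  assumes "a \<le> b"
  shows "emeasure (stieltjes_measure g) {a<..b} = ennreal (g (max 0 b) - g (max 0 a))"
proof -
  have "continuous_on UNIV (\<lambda>s. g (max 0 s))"
    by (rule continuous_on_compose2[OF cont]) (auto intro!: continuous_intros)
  then have "continuous (at_right x) (\<lambda>s. g (max 0 s))" for x
    by (simp add: continuous_on_eq_continuous_at continuous_at_imp_continuous_within)
  then show ?thesis
    unfolding stieltjes_measure_def
    by (intro emeasure_interval_measure_Ioc assms) (auto intro!: mono_onD[OF mono])
qed

lemma sets_stieltjes [measurable_cong]: "sets (stieltjes_measure g) = sets borel"
  by (simp add: stieltjes_measure_def)

lemma set_integrable_stieltjes: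
  fixes h :: "real \<Rightarrow> real"
  assumes h: "continuous_on {0..} h"
  shows "set_integrable (stieltjes_measure g) {0..t} h"
proof -
  have ch: "continuous_on {0..t} h"
    using h by (rule continuous_on_subset) auto
  then obtain B where B: "\<And>s. s \<in> {0..t} \<Longrightarrow> norm (h s) \<le> B"
    by (metis compact_Icc compact_continuous_image compact_imp_bounded bounded_iff imageI)
  \<comment> \<open>The measure is known on half-open intervals only. Starting at -1 includes the
    point 0, and \<open>max 0 t\<close> covers negative \<open>t\<close>.\<close>
  have "emeasure (stieltjes_measure g) {0..t} \<le> emeasure (stieltjes_measure g) {-1<..max 0 t}"
    by (rule emeasure_mono) (auto simp: sets_stieltjes)
  also have "\<dots> < \<infinity>"
    by (subst emeasure_stieltjes_Ioc) auto
  finally have fin: "emeasure (stieltjes_measure g) {0..t} < \<infinity>" .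
  have meas: "(\<lambda>s. indicator {0..t} s *\<^sub>R h s) \<in> borel_measurable (stieltjes_measure g)"
    using borel_measurable_continuous_on_indicator[OF _ ch]
    by (simp add: measurable_cong_sets[OF sets_stieltjes refl])
  show ?thesis
    unfolding set_integrable_def
    by (rule integrableI_bounded_set[where A = "{0..t}" and B = B])
       (use fin meas B in \<open>auto simp: sets_stieltjes\<close>)
qed

text \<open>A nonnegative integrand with zero integral vanishes almost everywhere. Since
  \<open>h\<close> is positive on \<open>{a<..b}\<close>, that interval is a null set, and its
  measure is the increment of \<open>g\<close>.\<close>

lemma stieltjes_integral_zero_imp_const:
  fixes h :: "real \<Rightarrow> real"
  assumes h: "continuous_on {0..} h"
    and nonneg: "\<And>s. s \<in> {0..t} \<Longrightarrow> 0 \<le> h s"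
    and zero: "(LINT s:{0..t}|stieltjes_measure g. h s) = 0"
    and ab: "0 \<le> a" "a \<le> b" "b \<le> t" and pos: "\<And>s. s \<in> {a..b} \<Longrightarrow> 0 < h s"
  shows "g b = g a"
proof -
  have "AE s in stieltjes_measure g. indicator {0..t} s *\<^sub>R h s = 0"
    using zero set_integrable_stieltjes[OF h, of t] nonneg
    unfolding set_lebesgue_integral_def set_integrable_def
    by (subst (asm) integral_nonneg_eq_0_iff_AE) (auto simp: indicator_def)
  then have "AE s in stieltjes_measure g. s \<notin> {a<..b}"
  proof eventually_elim
    case (elim s)
    with ab pos[of s] show ?case
      by (auto simp: indicator_def split: if_splits)
  qed
  then have "emeasure (stieltjes_measure g) {a<..b} = 0"
    by (subst (asm) AE_iff_measurable[OF _ refl])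
       (auto simp: sets_stieltjes stieltjes_measure_def greaterThanAtMost_def
          greaterThan_def atMost_def Int_def)
  then have "g b \<le> g a"
    using emeasure_stieltjes_Ioc[of a b] ab by (simp add: ennreal_eq_0_iff max_def)
  moreover have "g a \<le> g b"
    using ab by (auto intro!: mono_onD[OF mono])
  ultimately show ?thesis by simp
qed

end

section \<open>Consequences of the Skorohod conditions for one coordinate\<close>

text \<open>The obstacle condition makes each summand of the complementarity condition nonnegative,
  so a zero sum forces every summand to vanish.\<close>

lemma skorohod_solution_integral_zero:
  assumes V: "cont_path n V" and sol: "skorohod_solution n V Z \<eta>"
    and "k \<in> {1..n - 1}" and "0 \<le> t"
  shows "(LINT s:{0..t}|stieltjes_measure (\<lambda>r. \<eta> r k). Z s k + V s k) = 0"
proof -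
  have "0 \<le> (LINT s:{0..t}|stieltjes_measure (\<lambda>r. \<eta> r i). Z s i + V s i)"
    if i: "i \<in> {1..n - 1}" for i
    unfolding set_lebesgue_integral_def
  proof (rule Bochner_Integration.integral_nonneg)
    fix s
    show "0 \<le> indicator {0..t} s *\<^sub>R (Z s i + V s i)"
    proof (cases "s \<in> {0..t}")
      case True
      with sol i have "Z s i \<ge> - V s i" by (auto simp: skorohod_solution_def)
      then show ?thesis by (simp add: indicator_def)
    qed auto
  qed
  moreover have "(\<Sum>i = 1..n - 1.
      (LINT s:{0..t}|stieltjes_measure (\<lambda>r. \<eta> r i). Z s i + V s i)) = 0"
    using sol \<open>0 \<le> t\<close> by (auto simp: skorohod_solution_def)
  ultimately show ?thesis
    using \<open>k \<in> {1..n - 1}\<close> by (subst (asm) sum_nonneg_eq_0_iff) auto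
qed

text \<open>Complementarity in the form used below: the reflection term acts only while the solution
  touches its obstacle.\<close>

lemma skorohod_solution_const:
  assumes V: "cont_path n V" and sol: "skorohod_solution n V Z \<eta>"
    and k: "k \<in> {1..n - 1}" and ab: "0 \<le> a" "a \<le> b"
    and pos: "\<And>s. s \<in> {a..b} \<Longrightarrow> 0 < Z s k + V s k"
  shows "\<eta> b k = \<eta> a k"
proof (rule stieltjes_integral_zero_imp_const[where g = "\<lambda>r. \<eta> r k" and h = "\<lambda>s. Z s k + V s k" and t = b])
  show "continuous_on {0..} (\<lambda>s. Z s k + V s k)"
    using V sol k by (auto simp: skorohod_solution_def cont_path_def intro!: continuous_intros)
  show "0 \<le> Z s k + V s k" if "s \<in> {0..b}" for s
  proof -
    have "Z s k \<ge> - V s k" using sol k that by (auto simp: skorohod_solution_def)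
    then show ?thesis by simp
  qed
  show "(LINT s:{0..b}|stieltjes_measure (\<lambda>r. \<eta> r k). Z s k + V s k) = 0"
    using skorohod_solution_integral_zero[OF V sol k] ab by simp
qed (use sol k ab pos in \<open>auto simp: skorohod_solution_def cont_path_def\<close>)

lemma skorohod_solution_increment:
  assumes sol: "skorohod_solution n V Z \<eta>" and k: "k \<in> {1..n - 1}" and ab: "0 \<le> a" "a \<le> b"
  shows "Z b k - Z a k = integral {a..b} (\<lambda>s. (real n)\<^sup>2 * lap_mult n (Z s) k) + (\<eta> b k - \<eta> a k)"
proof -
  let ?f = "\<lambda>s. (real n)\<^sup>2 * lap_mult n (Z s) k"
  have "continuous_on {0..} ?f"
    using sol by (auto simp: skorohod_solution_def intro!: continuous_intros continuous_on_lap_mult)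
  then have "?f integrable_on {0..b}"
    by (intro integrable_continuous_interval) (rule continuous_on_subset, auto)
  then have "integral {0..a} ?f + integral {a..b} ?f = integral {0..b} ?f"
    using ab by (intro Henstock_Kurzweil_Integration.integral_combine) auto
  moreover have "Z t k = integral {0..t} ?f + \<eta> t k" if "0 \<le> t" for t
    using sol k that by (auto simp: skorohod_solution_def)
  ultimately show ?thesis
    using ab by (smt (verit))
qed

section \<open>Comparison with the barrier\<close>

text \<open>At the hitting time coordinate \<open>k\<close> is a nonnegative maximum of the
  difference, so its drift there is at most 0 and just before stays below \<open>e\<close>.
  Reflection cannot raise the difference on that short interval either. The difference thus grows no
  faster than the barrier, whose slope is \<open>e\<close>, and started strictly below it.\<close>

lemma skorohod_no_first_crossing:
  assumes V1: "cont_path n V1" and V2: "cont_path n V2"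
    and sol1: "skorohod_solution n V1 Z1 \<eta>1" and sol2: "skorohod_solution n V2 Z2 \<eta>2"
    and k: "k \<in> {1..n - 1}" and "0 < \<tau>"
    and K: "\<And>t. t \<in> {0..\<tau>} \<Longrightarrow> V2 t k - V1 t k \<le> K" and "0 \<le> K"
    and "0 < e"
    and before: "\<And>t. 0 \<le> t \<Longrightarrow> t < \<tau> \<Longrightarrow> Z1 t k - Z2 t k < K + e * (1 + t)"
    and at: "\<And>j. j \<in> {1..n - 1} \<Longrightarrow> Z1 \<tau> j - Z2 \<tau> j \<le> K + e * (1 + \<tau>)"
    and hit: "Z1 \<tau> k - Z2 \<tau> k = K + e * (1 + \<tau>)"
  shows False
proof -
  let ?W = "\<lambda>s j. Z1 s j - Z2 s j"
  let ?f = "\<lambda>s. (real n)\<^sup>2 * lap_mult n (?W s) k"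
  have Z: "cont_path n Z1" "cont_path n Z2"
    using sol1 sol2 by (auto simp: skorohod_solution_def)
  have W: "cont_path n ?W"
    using Z by (auto simp: cont_path_def intro!: continuous_intros)
  have cW: "continuous_on {0..} (\<lambda>s. ?W s k)"
    using W k by (auto simp: cont_path_def)
  have cf: "continuous_on {0..} ?f"
    by (intro continuous_intros continuous_on_lap_mult W)
  have lim: "(h \<longlongrightarrow> h \<tau>) (at_left \<tau>)" if "continuous_on {0..} h" for h :: "real \<Rightarrow> real"
  proof -
    have "isCont h \<tau>"
      using that \<open>0 < \<tau>\<close> by (intro continuous_on_interior[of "{0..}"]) auto
    then show ?thesis
      by (auto simp: isCont_def intro: filterlim_mono[OF _ order_refl] at_le)
  qed
  have e\<tau>: "0 < e * (1 + \<tau>)"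
    using \<open>0 < e\<close> \<open>0 < \<tau>\<close> by simp
  have "?f \<tau> \<le> 0"
    using lap_mult_nonpos_at_max[OF k, of "?W \<tau>"] at hit \<open>0 \<le> K\<close> e\<tau>
    by (auto simp: mult_nonneg_nonpos)
  then have "\<forall>\<^sub>F s in at_left \<tau>. ?f s < e"
    using order_tendstoD(2)[OF lim[OF cf], of e] \<open>0 < e\<close> by simp
  moreover have "\<forall>\<^sub>F s in at_left \<tau>. K < ?W s k"
    using order_tendstoD(1)[OF lim[OF cW], of K] hit e\<tau> by simp
  moreover have "\<forall>\<^sub>F s in at_left \<tau>. 0 < s"
    using eventually_at_left_real[OF \<open>0 < \<tau>\<close>] by eventually_elim simp
  ultimately have "\<forall>\<^sub>F s in at_left \<tau>. ?f s < e \<and> K < ?W s k \<and> 0 < s"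
    by eventually_elim simp
  then obtain c where c: "c < \<tau>" "\<And>s. c < s \<Longrightarrow> s < \<tau> \<Longrightarrow> ?f s < e \<and> K < ?W s k \<and> 0 < s"
    by (auto simp: eventually_at_left[of "\<tau> - 1" \<tau>])
  \<comment> \<open>The midpoint keeps the closed interval from \<open>a\<close> to
    \<open>\<tau>\<close> inside the neighbourhood, with the endpoint \<open>\<tau>\<close> treated
    separately.\<close>
  define a where "a = (c + \<tau>) / 2"
  have a: "c < a" "a < \<tau>" "0 < a"
    using c(1) c(2)[of "(c + \<tau>) / 2"] by (simp_all add: a_def)
  have near: "?f s \<le> e" "K < ?W s k" if "s \<in> {a..\<tau>}" for s
    using that a c(2)[of s] \<open>?f \<tau> \<le> 0\<close> \<open>0 < e\<close> hit e\<tau> by (cases "s = \<tau>"; force)+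
  have "\<eta>1 \<tau> k = \<eta>1 a k"
  proof (rule skorohod_solution_const[OF V1 sol1 k])
    fix s assume s: "s \<in> {a..\<tau>}"
    then have "Z2 s k \<ge> - V2 s k"
      using sol2 k a by (auto simp: skorohod_solution_def)
    \<comment> \<open>Here \<open>Z1 + V1 > Z2 + K + V1\<close>, which is at least
      \<open>Z2 + V2\<close> and hence nonnegative.\<close>
    then show "0 < Z1 s k + V1 s k"
      using near(2)[OF s] K[of s] s a by auto
  qed (use a in auto)
  \<comment> \<open>The term \<open>\<eta>2\<close> enters the difference with a minus sign, so
    monotonicity suffices.\<close>
  moreover have "\<eta>2 a k \<le> \<eta>2 \<tau> k"
  proof (rule mono_onD[where f = "\<lambda>t. \<eta>2 t k"])
    show "mono_on {0..} (\<lambda>t. \<eta>2 t k)"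
      using sol2 k by (auto simp: skorohod_solution_def)
  qed (use a in auto)
  moreover have "integral {a..\<tau>} ?f = integral {a..\<tau>} (\<lambda>s. (real n)\<^sup>2 * lap_mult n (Z1 s) k)
      - integral {a..\<tau>} (\<lambda>s. (real n)\<^sup>2 * lap_mult n (Z2 s) k)"
  proof -
    have "(\<lambda>s. (real n)\<^sup>2 * lap_mult n (Z s) k) integrable_on {a..\<tau>}" if "cont_path n Z" for Z
    proof (intro integrable_continuous_interval)
      have "continuous_on {0..} (\<lambda>s. (real n)\<^sup>2 * lap_mult n (Z s) k)"
        by (intro continuous_intros continuous_on_lap_mult that)
      then show "continuous_on {a..\<tau>} (\<lambda>s. (real n)\<^sup>2 * lap_mult n (Z s) k)"
        by (rule continuous_on_subset) (use a in auto)
    qed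
    with Z show ?thesis
      by (simp add: lap_mult_diff right_diff_distrib Henstock_Kurzweil_Integration.integral_diff)
  qed
  moreover have "integral {a..\<tau>} ?f \<le> e * (\<tau> - a)"
  proof -
    have "continuous_on {a..\<tau>} ?f"
      using cf by (rule continuous_on_subset) (use a in auto)
    then have "integral {a..\<tau>} ?f \<le> integral {a..\<tau>} (\<lambda>_. e)"
      by (intro integral_le integrable_continuous_interval) (use near in auto)
    then show ?thesis
      using a by (simp add: mult.commute)
  qed
  ultimately have "?W \<tau> k - ?W a k \<le> e * (\<tau> - a)"
    using skorohod_solution_increment[OF sol1 k, of a \<tau>]
      skorohod_solution_increment[OF sol2 k, of a \<tau>] a by simp
  moreover have "?W a k < K + e * (1 + a)"
    using before a by simp
  ultimately show False
    using hit by (simp add: algebra_simps)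
qed

lemma skorohod_one_sided_bound:
  assumes V1: "cont_path n V1" and V2: "cont_path n V2"
    and sol1: "skorohod_solution n V1 Z1 \<eta>1" and sol2: "skorohod_solution n V2 Z2 \<eta>2"
    and K: "\<And>t j. t \<in> {0..T} \<Longrightarrow> j \<in> {1..n - 1} \<Longrightarrow> V2 t j - V1 t j \<le> K" and "0 \<le> K"
    and k: "k \<in> {1..n - 1}" and t: "t \<in> {0..T}"
  shows "Z1 t k - Z2 t k \<le> K"
proof -
  have below: "Z1 t j - Z2 t j < K + e * (1 + t)"
    if "0 < e" "j \<in> {1..n - 1}" "t \<in> {0..T}" for e t j
  proof (rule ccontr)
    assume contr: "\<not> ?thesis"
    let ?g = "\<lambda>j s. Z1 s j - Z2 s j - (K + e * (1 + s))"
    \<comment> \<open>Times at which some coordinate has reached the barrier. As a finite union of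
      closed sets bounded below, this set contains its infimum, the first crossing time.\<close>
    let ?S = "\<Union>j\<in>{1..n - 1}. {s \<in> {0..T}. 0 \<le> ?g j s}"
    have cg: "continuous_on {0..} (?g j)" if "j \<in> {1..n - 1}" for j
      using sol1 sol2 that
      by (auto simp: skorohod_solution_def cont_path_def intro!: continuous_intros)
    have "closed {s \<in> {0..T}. 0 \<le> ?g j s}" if "j \<in> {1..n - 1}" for j
      by (rule continuous_on_closed_Collect_le)
         (auto intro!: continuous_on_subset[OF cg[OF that]] simp del: diff_ge_0_iff_ge)
    then have "closed ?S" by (intro closed_UN) auto
    moreover have "?S \<noteq> {}" using contr that by fastforce
    moreover have bdd: "bdd_below ?S" by (intro bdd_belowI[of _ 0]) auto
    ultimately have "Inf ?S \<in> ?S" by (intro closed_contains_Inf)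
    define \<tau> where "\<tau> = Inf ?S"
    have \<tau>S: "\<tau> \<in> ?S" unfolding \<tau>_def by fact
    then obtain i where i: "i \<in> {1..n - 1}" and \<tau>: "\<tau> \<in> {0..T}" and hit: "0 \<le> ?g i \<tau>"
      by auto
    have before: "?g j s < 0" if "0 \<le> s" "s < \<tau>" "j \<in> {1..n - 1}" for j s
    proof (rule ccontr)
      assume "\<not> ?g j s < 0"
      with that \<tau> have "s \<in> ?S" by fastforce
      then have "\<tau> \<le> s" unfolding \<tau>_def by (rule cInf_lower[OF _ bdd])
      with that show False by simp
    qed
    \<comment> \<open>Both solutions start at 0, whereas the barrier starts at
      \<open>K + e > 0\<close>; the crossing time is therefore positive and has a left
      neighbourhood.\<close>
    have "Z1 0 i = 0" "Z2 0 i = 0"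
      using sol1 sol2 i by (auto simp: skorohod_solution_def)
    with hit \<open>0 \<le> K\<close> \<open>0 < e\<close> have "\<tau> \<noteq> 0" by auto
    with \<tau> have "0 < \<tau>" by auto
    \<comment> \<open>Left limits of the strict inequalities before \<open>\<tau>\<close> bound all
      coordinates at \<open>\<tau>\<close>. Hence the coordinate \<open>i\<close> that reaches the
      barrier meets it with equality and is maximal.\<close>
    have at: "?g j \<tau> \<le> 0" if j: "j \<in> {1..n - 1}" for j
    proof (rule tendsto_upperbound)
      have "isCont (?g j) \<tau>"
        using cg[OF j] \<open>0 < \<tau>\<close> by (intro continuous_on_interior[of "{0..}"]) auto
      then show "(?g j \<longlongrightarrow> ?g j \<tau>) (at_left \<tau>)"
        by (auto simp: isCont_def intro: filterlim_mono[OF _ order_refl] at_le)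
      show "\<forall>\<^sub>F s in at_left \<tau>. ?g j s \<le> 0"
        using eventually_at_left_real[OF \<open>0 < \<tau>\<close>]
      proof eventually_elim
        case (elim s)
        with before[of s j] j show ?case by simp
      qed
    qed simp
    show False
    proof (rule skorohod_no_first_crossing[OF V1 V2 sol1 sol2 i \<open>0 < \<tau>\<close> _ \<open>0 \<le> K\<close> \<open>0 < e\<close>])
      show "Z1 \<tau> i - Z2 \<tau> i = K + e * (1 + \<tau>)" using at[OF i] hit by simp
      show "Z1 \<tau> j - Z2 \<tau> j \<le> K + e * (1 + \<tau>)" if "j \<in> {1..n - 1}" for j
        using at[OF that] by simp
      show "Z1 s i - Z2 s i < K + e * (1 + s)" if "0 \<le> s" "s < \<tau>" for s
        using before[OF that i] by simp
      show "V2 s i - V1 s i \<le> K" if "s \<in> {0..\<tau>}" for s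
        using K[OF _ i, of s] that \<tau> by auto
    qed
  qed
  show ?thesis
  proof (rule field_le_epsilon)
    fix d :: real assume "0 < d"
    \<comment> \<open>With \<open>e = d / (1 + t)\<close> the barrier at time \<open>t\<close>
      equals \<open>K + d\<close>.\<close>
    then have "Z1 t k - Z2 t k < K + d / (1 + t) * (1 + t)"
      using t by (intro below k) auto
    then show "Z1 t k - Z2 t k \<le> K + d"
      using t by simp
  qed
qed

section \<open>From the one-sided bound to suprema\<close>

theorem lemma3p2:
  fixes n :: nat
    and V1 V2 Z1 Z2 \<eta>1 \<eta>2 :: "real \<Rightarrow> nat \<Rightarrow> real"
    and k :: nat and T :: real
  assumes "n \<ge> 2"
    and "cont_path n V1"
    and "cont_path n V2"
    and "skorohod_solution n V1 Z1 \<eta>1"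
    and "skorohod_solution n V2 Z2 \<eta>2"
    and "k \<in> {1..n - 1}"
    and "T > 0"
  shows "(SUP t\<in>{0..T}. \<bar>Z1 t k - Z2 t k\<bar>)
         \<le> (SUP (t, j)\<in>{0..T} \<times> {1..n - 1}. \<bar>V1 t j - V2 t j\<bar>)"
    (is "_ \<le> ?K")
proof -
  let ?f = "\<lambda>(t, j). \<bar>V1 t j - V2 t j\<bar>"
  \<comment> \<open>A real supremum bounds its set only once that set is known to be bounded; here
    it is a finite union of continuous images of a compact interval.\<close>
  have "bdd_above ((\<lambda>t. \<bar>V1 t j - V2 t j\<bar>) ` {0..T})" if "j \<in> {1..n - 1}" for j
  proof -
    have "continuous_on {0..} (\<lambda>t. \<bar>V1 t j - V2 t j\<bar>)"
      using assms(2,3) that by (auto simp: cont_path_def intro!: continuous_intros)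
    then have "continuous_on {0..T} (\<lambda>t. \<bar>V1 t j - V2 t j\<bar>)"
      by (rule continuous_on_subset) auto
    then show ?thesis
      by (intro bounded_imp_bdd_above compact_imp_bounded compact_continuous_image) auto
  qed
  then have "bdd_above (\<Union>j\<in>{1..n - 1}. (\<lambda>t. \<bar>V1 t j - V2 t j\<bar>) ` {0..T})"
    by (subst bdd_above_UN) auto
  then have bdd: "bdd_above (?f ` ({0..T} \<times> {1..n - 1}))"
    by (rule bdd_above_mono) auto
  have le: "\<bar>V1 t j - V2 t j\<bar> \<le> ?K" if "t \<in> {0..T}" "j \<in> {1..n - 1}" for t j
    using cSUP_upper[OF _ bdd, of "(t, j)"] that by auto
  have "0 \<le> \<bar>V1 0 k - V2 0 k\<bar>" by simp
  also have "\<dots> \<le> ?K" using assms by (intro le) auto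
  finally have "0 \<le> ?K" .
  have V: "V2 t j - V1 t j \<le> ?K" "V1 t j - V2 t j \<le> ?K"
    if "t \<in> {0..T}" "j \<in> {1..n - 1}" for t j
    using le[OF that] by linarith+
  show ?thesis
  proof (rule cSUP_least)
    fix t assume t: "t \<in> {0..T}"
    \<comment> \<open>The absolute value comes from applying the one-sided bound twice, with the
      roles of the two solutions exchanged.\<close>
    show "\<bar>Z1 t k - Z2 t k\<bar> \<le> ?K"
      using skorohod_one_sided_bound[OF assms(2-5) V(1) \<open>0 \<le> ?K\<close> assms(6) t]
        skorohod_one_sided_bound[OF assms(3,2,5,4) V(2) \<open>0 \<le> ?K\<close> assms(6) t]
      by linarith
  qed (use \<open>T > 0\<close> in auto)
qed

end
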